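(* Let $n\ge 1$ and let $\mathcal F=\{f_j\}_{j=1}^k$ be a family of vectors in $\mathbb Z_2^n$. Then $\mathcal F$ is a frame if and only if there exist vectors $\{g_j\}_{j=1}^k$ in $\mathbb Z_2^n$ such that for all $y\in\mathbb Z_2^n$ $$y=\sum_{j=1}^k (y,g_j)\,f_j .$$
   Context: $\mathbb Z_2$ is the field with two elements. A family (finite indexed list, repetitions allowed) $\{f_1,\dots,f_k\}$ of vectors in $\mathbb Z_2^n$ is a frame if it spans $\mathbb Z_2^n$. The dot product $(\cdot,\cdot):\mathbb Z_2^n\times\mathbb Z_2^n\to\mathbb Z_2$ is the bilinear map $(a,b)=\sum_{i=1}^n a_ib_i$ (sum in $\mathbb Z_2$). *)

theory Defs
  imports "HOL-Analysis.Analysis" "HOL-Library.Z2"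
begin

text \<open>
  The field with two elements is the library type \<^typ>\<open>bit\<close>, and the space of column
  vectors over it is \<open>bit ^ 'n\<close>, with \<open>n = CARD('n) \<ge> 1\<close>. A family of \<open>k\<close> vectors is a
  function on \<^typ>\<open>nat\<close> of which only the values at \<open>1, \<dots>, k\<close> are used; repetitions
  are allowed, and \<open>k = 0\<close> is the empty family.
\<close>

definition dot :: "bit ^ 'n \<Rightarrow> bit ^ 'n \<Rightarrow> bit"
  where "dot a b = (\<Sum>i\<in>UNIV. a $ i * b $ i)"

text \<open>Here \<^const>\<open>vec.span\<close> is the \<^typ>\<open>bit\<close>-linear span, for the scalar multiplication \<open>*s\<close>.\<close>

definition is_frame :: "nat \<Rightarrow> (nat \<Rightarrow> bit ^ 'n) \<Rightarrow> bool"
  where "is_frame k f \<longleftrightarrow> vec.span (f ` {1..k}) = UNIV"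

end

theory Submission
  imports Defs
begin

text \<open>A dual family is a right inverse of the synthesis map, which sends coefficients
  \<open>c\<close> to the sum of the \<open>c j *s f j\<close>. By \<open>span_image_eq_sums\<close>
  its range is the span of the family. If it is onto, expand each standard basis vector as the sum
  of \<open>c i j *s f j\<close> and let \<open>g j\<close> have i-th coordinate
  \<open>c i j\<close>; linearity in \<open>y\<close> gives the formula. Conversely, the formula
  writes every \<open>y\<close> as a combination of the family. No inner product is needed, only
  bilinearity of \<open>dot\<close>.\<close>

lemma span_image_eq_sums:
  fixes f :: "'i \<Rightarrow> 'a::field ^ 'n"
  assumes "finite A"
  shows "vec.span (f ` A) = range (\<lambda>c. \<Sum>j\<in>A. c j *s f j)" (is "_ = ?R")
proof
  show "vec.span (f ` A) \<subseteq> ?R"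
  proof (rule vec.span_minimal)
    show "f ` A \<subseteq> ?R"
    proof (rule image_subsetI)
      fix a assume "a \<in> A"
      \<comment> \<open>The indicator of \<open>a\<close> as coefficient function picks out
        \<open>f a\<close>.\<close>
      have "(\<Sum>j\<in>A. of_bool (j = a) *s f j) = (\<Sum>j\<in>A. if j = a then f a else 0)"
        by (rule sum.cong) auto
      also have "\<dots> = f a"
        using assms \<open>a \<in> A\<close> by simp
      finally show "f a \<in> ?R" by (intro image_eqI[where x = "\<lambda>j. of_bool (j = a)"]) auto
    qed
    show "vec.subspace ?R"
    proof (rule vec.subspaceI)
      show "0 \<in> ?R"
        by (rule image_eqI[where x = "\<lambda>_. 0"]) simp_all
    next
      fix x y assume "x \<in> ?R" "y \<in> ?R"
      then obtain c d where "x = (\<Sum>j\<in>A. c j *s f j)" "y = (\<Sum>j\<in>A. d j *s f j)"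
        by blast
      then have "x + y = (\<Sum>j\<in>A. (c j + d j) *s f j)"
        by (simp add: vec.scale_left_distrib sum.distrib)
      then show "x + y \<in> ?R" by (rule image_eqI[where x = "\<lambda>j. c j + d j"]) simp
    next
      fix r x assume "x \<in> ?R"
      then obtain c where "x = (\<Sum>j\<in>A. c j *s f j)"
        by blast
      then have "r *s x = (\<Sum>j\<in>A. (r * c j) *s f j)"
        by (simp add: vec.scale_sum_right)
      then show "r *s x \<in> ?R" by (rule image_eqI[where x = "\<lambda>j. r * c j"]) simp
    qed
  qed
  show "?R \<subseteq> vec.span (f ` A)"
    by (auto intro: vec.span_sum vec.span_scale vec.span_base)
qed

theorem theorem2p4:
  fixes f :: "nat \<Rightarrow> bit ^ 'n" and k :: nat
  shows "is_frame k f \<longleftrightarrow>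
    (\<exists>g :: nat \<Rightarrow> bit ^ 'n. \<forall>y :: bit ^ 'n. y = (\<Sum>j = 1..k. dot y (g j) *s f j))"
proof
  assume "is_frame k f"
  then have "axis i 1 \<in> range (\<lambda>c. \<Sum>j = 1..k. c j *s f j)" for i
    by (simp add: is_frame_def flip: span_image_eq_sums)
  then have "\<forall>i. \<exists>c. axis i 1 = (\<Sum>j = 1..k. c j *s f j)"
    by blast
  then obtain c where c: "\<And>i. axis i 1 = (\<Sum>j = 1..k. c i j *s f j)"
    by metis
  \<comment> \<open>With the \<open>c i\<close> as rows of a matrix, \<open>g j\<close> is its j-th
    column: \<open>dot y (g j)\<close> collects what all coordinates of \<open>y\<close> contribute
    to the coefficient of \<open>f j\<close>.\<close>
  have "y = (\<Sum>j = 1..k. dot y (\<chi> i. c i j) *s f j)" for y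
  proof -
    have "y = (\<Sum>i\<in>UNIV. y $ i *s axis i 1)"
      by (simp add: basis_expansion)
    also have "\<dots> = (\<Sum>i\<in>UNIV. \<Sum>j = 1..k. (y $ i * c i j) *s f j)"
      by (simp only: c vec.scale_sum_right vec.scale_scale)
    also have "\<dots> = (\<Sum>j = 1..k. \<Sum>i\<in>UNIV. (y $ i * c i j) *s f j)"
      by (rule sum.swap)
    also have "\<dots> = (\<Sum>j = 1..k. dot y (\<chi> i. c i j) *s f j)"
      by (simp only: dot_def vec_lambda_beta vec.scale_sum_left)
    finally show ?thesis .
  qed
  then show "\<exists>g. \<forall>y. y = (\<Sum>j = 1..k. dot y (g j) *s f j)"
    by (intro exI[where x = "\<lambda>j. \<chi> i. c i j"]) blast
next
  assume "\<exists>g. \<forall>y. y = (\<Sum>j = 1..k. dot y (g j) *s f j)"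
  then obtain g where g: "\<And>y. y = (\<Sum>j = 1..k. dot y (g j) *s f j)"
    by blast
  \<comment> \<open>The numbers \<open>dot y (g j)\<close> serve directly as coefficients.\<close>
  have "y \<in> range (\<lambda>c. \<Sum>j = 1..k. c j *s f j)" for y
    by (rule image_eqI[where x = "\<lambda>j. dot y (g j)"], rule g) simp
  then show "is_frame k f"
    by (auto simp: is_frame_def span_image_eq_sums)
qed

end
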